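(* Let $N\ge 2$ and $\nu>0$. For each $x_0\in C_N^B$ there is a unique continuous function $x:[0,\infty[\to C_N^B$ with $x(0)=x_0$ such that $x(t)\in W_N^B$ for all $t\in\,]0,\infty[$ and such that $x:\,]0,\infty[\to W_N^B$ satisfies the ODE $$\frac{dx_i(t)}{dt}=\sum_{j\ne i}\Bigl(\frac{1}{x_i(t)-x_j(t)}+\frac{1}{x_i(t)+x_j(t)}\Bigr)+\frac{\nu}{x_i(t)}\qquad (i=1,\ldots,N,\ t>0).$$
   Context: $C_N^B:=\{x\in\mathbb R^N:\ x_1\ge x_2\ge\cdots\ge x_N\ge 0\}$ is the closed Weyl chamber of type $B_N$, and $W_N^B=\{x\in\mathbb R^N:\ x_1>x_2>\cdots>x_N>0\}$ is its interior. In sums $\sum_{j\neq i}$ the index $j$ runs over $\{1,\ldots,N\}\setminus\{i\}$. *)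

theory Defs
  imports "HOL-Analysis.Analysis"
begin

text \<open>
  The coordinates of \<open>\<real>\<^sup>N\<close> are indexed by a finite linearly ordered type \<open>'n\<close> with
  \<open>CARD('n) = N\<close>; its order plays the role of \<open>1 < 2 < \<dots> < N\<close>. Every \<open>N \<ge> 1\<close> occurs
  as such a type (e.g. the numeral types). The chains of inequalities
  are written for all pairs of indices, and the bound on the last coordinate for all coordinates.
\<close>

definition weyl_chamber_B :: "(real ^ 'n::{finite,linorder}) set" where
  "weyl_chamber_B = {x. (\<forall>i j. i < j \<longrightarrow> x $ i \<ge> x $ j) \<and> (\<forall>i. x $ i \<ge> 0)}"

definition open_weyl_chamber_B :: "(real ^ 'n::{finite,linorder}) set" where
  "open_weyl_chamber_B = {x. (\<forall>i j. i < j \<longrightarrow> x $ i > x $ j) \<and> (\<forall>i. x $ i > 0)}"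

end

theory Submission
  imports Defs
begin

text \<open>
  The equation is the gradient flow of the convex function
  \<open>x \<mapsto> - \<Sum>i<j. ln (x\<^sub>i\<^sup>2 - x\<^sub>j\<^sup>2) - \<nu> * \<Sum>i. ln x\<^sub>i\<close>, a sum of terms \<open>- c * ln (a \<bullet> x)\<close> for linear
  forms \<open>a\<close> that are positive on the chamber. Since the drift is monotone, the flow contracts
  distances, which gives uniqueness. From an interior point the flow exists because the energy
  decreases and is infinite on the boundary. From a boundary point it is the limit of the flows
  started at nearby interior points: these converge uniformly by contraction, and the bound
  \<open>energy (x t) \<le> energy z + (norm (x 0 - z))\<^sup>2 / (2 * t)\<close>, valid for all interior \<open>z\<close>, keeps the limit
  inside the open chamber at positive times.
\<close>

section \<open>Picard iteration for globally Lipschitz fields\<close>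

text \<open>Intended for the truncated drift: a global Lipschitz constant makes the Picard iterates
  converge uniformly on all of \<open>{0..T}\<close>, so no local solutions have to be
  glued.\<close>

lemma global_picard_lindelof:
  fixes f :: "'a::euclidean_space \<Rightarrow> 'a"
  assumes lip: "L-lipschitz_on UNIV f" and T: "0 \<le> T"
  obtains x where "x 0 = x0"
    "\<And>t. t \<in> {0..T} \<Longrightarrow> (x has_vector_derivative f (x t)) (at t within {0..T})"
proof -
  \<comment> \<open>The maximum with 1 makes the constant strictly positive, so that tolerances can
    be divided by \<open>K\<close>.\<close>
  define K where "K = max L 1"
  have K: "K > 0" "K-lipschitz_on UNIV f"
    using lipschitz_on_mono[OF lip subset_refl, of K] by (auto simp: K_def)
  have contf: "continuous_on S (\<lambda>s. f (g s))" if "continuous_on S g" for S and g :: "real \<Rightarrow> 'a"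
    using continuous_on_compose2[OF lipschitz_on_continuous_on[OF K(2)] that] by simp
  define u where "u = rec_nat (\<lambda>t::real. x0) (\<lambda>k v t. x0 + integral {0..t} (\<lambda>s. f (v s)))"
  have u0: "u 0 = (\<lambda>t. x0)" and uS: "\<And>k. u (Suc k) = (\<lambda>t. x0 + integral {0..t} (\<lambda>s. f (u k s)))"
    by (simp_all add: u_def)
  have der_step: "(u (Suc k) has_vector_derivative f (u k t)) (at t within {0..T})"
    if "continuous_on {0..T} (u k)" "t \<in> {0..T}" for k t
    unfolding uS
    using has_vector_derivative_add[OF has_vector_derivative_const
        integral_has_vector_derivative[OF contf[OF that(1)] that(2)]] by simp
  have cont: "continuous_on {0..T} (u k)" for k
  proof (induction k)
    case (Suc k)
    then show ?case
      by (intro continuous_on_vector_derivative[OF der_step]) auto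
  qed (simp add: u0)
  note der = der_step[OF cont]
  have "bounded ((\<lambda>t. u (Suc 0) t - u 0 t) ` {0..T})"
    by (intro compact_imp_bounded compact_continuous_image continuous_intros cont) auto
  then obtain C where C: "\<And>t. t \<in> {0..T} \<Longrightarrow> norm (u (Suc 0) t - u 0 t) \<le> C"
    unfolding bounded_iff by blast
  with T have "C \<ge> 0"
    by (metis atLeastAtMost_iff norm_ge_zero order_refl order_trans)
  \<comment> \<open>in the weighted norm \<open>sup exp (- 2 * K * t) * norm (u t)\<close> the Picard iteration halves distances\<close>
  have diff: "norm (u (Suc k) t - u k t) \<le> C * (1/2)^k * exp (2 * K * t)" if "t \<in> {0..T}" for k t
    using that
  proof (induction k arbitrary: t)
    case 0
    have "C * 1 \<le> C * exp (2 * K * t)"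
      using 0 \<open>C \<ge> 0\<close> K by (intro mult_left_mono) auto
    with C[OF 0] show ?case by simp
  next
    case (Suc k)
    have sub: "{0..t} \<subseteq> {0..T}" using Suc.prems by auto
    have ct: "continuous_on {0..t} (\<lambda>s. f (u j s))" for j
      by (intro contf continuous_on_subset[OF cont sub])
    \<comment> \<open>Integrating \<open>exp (2 * K * s)\<close> divides by \<open>2 * K\<close>;
      the Lipschitz factor cancels \<open>K\<close>, and the halving remains.\<close>
    have "((\<lambda>s. K * (C * (1/2)^k * exp (2 * K * s))) has_integral
        (C * (1/2)^Suc k * exp (2 * K * t) - C * (1/2)^Suc k * exp (2 * K * 0))) {0..t}"
      using Suc.prems K
      by (intro fundamental_theorem_of_calculus)
         (auto intro!: derivative_eq_intros simp flip: has_real_derivative_iff_has_vector_derivative)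
    then have I: "((\<lambda>s. K * (C * (1/2)^k * exp (2 * K * s))) has_integral
        (C * (1/2)^Suc k * (exp (2 * K * t) - 1))) {0..t}"
      by (simp add: algebra_simps diff_divide_distrib)
    have "u (Suc (Suc k)) t - u (Suc k) t = integral {0..t} (\<lambda>s. f (u (Suc k) s) - f (u k s))"
      unfolding integral_diff[OF integrable_continuous_real[OF ct] integrable_continuous_real[OF ct]]
      by (simp add: uS)
    also have "norm \<dots> \<le> integral {0..t} (\<lambda>s. K * (C * (1/2)^k * exp (2 * K * s)))"
    proof (rule integral_norm_bound_integral)
      fix s assume "s \<in> {0..t}"
      with sub have "norm (u (Suc k) s - u k s) \<le> C * (1/2)^k * exp (2 * K * s)"
        by (intro Suc.IH) auto
      then have "K * norm (u (Suc k) s - u k s) \<le> K * (C * (1/2)^k * exp (2 * K * s))"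
        using K by (intro mult_left_mono) auto
      then show "norm (f (u (Suc k) s) - f (u k s)) \<le> K * (C * (1/2)^k * exp (2 * K * s))"
        using lipschitz_on_normD[OF K(2), of "u (Suc k) s" "u k s"] by simp
    qed (rule has_integral_integrable[OF I] | intro integrable_continuous_real continuous_on_diff ct)+
    also have "\<dots> = C * (1/2)^Suc k * (exp (2 * K * t) - 1)"
      using I by (rule integral_unique)
    also have "\<dots> \<le> C * (1/2)^Suc k * exp (2 * K * t)"
      using \<open>C \<ge> 0\<close> by (intro mult_left_mono) auto
    finally show ?case .
  qed
  have "uniform_limit {0..T} (\<lambda>n t. \<Sum>k<n. u (Suc k) t - u k t)
      (\<lambda>t. \<Sum>k. u (Suc k) t - u k t) sequentially"
  proof (rule Weierstrass_m_test)
    show "norm (u (Suc k) t - u k t) \<le> C * (1/2)^k * exp (2 * K * T)" if "t \<in> {0..T}" for k t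
    proof -
      have "C * (1/2)^k * exp (2 * K * t) \<le> C * (1/2)^k * exp (2 * K * T)"
        using that K \<open>C \<ge> 0\<close> by (intro mult_left_mono) auto
      with diff[OF that, of k] show ?thesis by linarith
    qed
    show "summable (\<lambda>k. C * (1/2)^k * exp (2 * K * T))"
      by (intro summable_mult summable_mult2 summable_geometric) auto
  qed
  moreover have telescope: "(\<Sum>k<n. u (Suc k) t - u k t) = u n t - x0" for n t
    using sum_lessThan_telescope[of "\<lambda>k. u k t" n] by (simp only: u0)
  ultimately have "uniform_limit {0..T} (\<lambda>n t. u n t - x0) (\<lambda>t. \<Sum>k. u (Suc k) t - u k t) sequentially"
    by (simp only:)
  from uniform_limit_add[OF this uniform_limit_const, of "\<lambda>_. x0"]
  have "uniform_limit {0..T} u (\<lambda>t. (\<Sum>k. u (Suc k) t - u k t) + x0) sequentially"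
    by simp
  then obtain x where x: "uniform_limit {0..T} u x sequentially" ..
  \<comment> \<open>Since \<open>u (Suc n)\<close> has derivative \<open>f (u n)\<close>, the
    derivatives of the shifted sequence converge uniformly to \<open>f (x t)\<close>. The limit
    \<open>g\<close> is afterwards identified with \<open>x\<close> on
    \<open>{0..T}\<close>.\<close>
  have "\<exists>g. \<forall>t\<in>{0..T}. (\<lambda>n. u (Suc n) t) \<longlonglongrightarrow> g t \<and>
      (g has_derivative (\<lambda>h. h *\<^sub>R f (x t))) (at t within {0..T})"
  proof (rule has_derivative_sequence)
    show "(u (Suc n) has_derivative (\<lambda>h. h *\<^sub>R f (u n t))) (at t within {0..T})" if "t \<in> {0..T}" for n t
      using der[OF that] by (simp add: has_vector_derivative_def)
    show "\<forall>\<^sub>F n in sequentially. \<forall>t\<in>{0..T}. \<forall>h. norm (h *\<^sub>R f (u n t) - h *\<^sub>R f (x t)) \<le> e * norm h"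
      if "e > 0" for e
    proof -
      have "\<forall>\<^sub>F n in sequentially. \<forall>t\<in>{0..T}. dist (u n t) (x t) < e / K"
        using uniform_limitD[OF x, of "e / K"] that K by simp
      then show ?thesis
      proof (eventually_elim, intro ballI allI)
        fix n t h assume "\<forall>t\<in>{0..T}. dist (u n t) (x t) < e / K" "t \<in> {0..T}"
        then have "K * norm (u n t - x t) \<le> e"
          using K by (auto simp: dist_norm field_simps intro: less_imp_le)
        then have "norm (f (u n t) - f (x t)) \<le> e"
          using lipschitz_on_normD[OF K(2), of "u n t" "x t"] by simp
        then have "\<bar>h\<bar> * norm (f (u n t) - f (x t)) \<le> \<bar>h\<bar> * e"
          by (intro mult_left_mono) auto
        then show "norm (h *\<^sub>R f (u n t) - h *\<^sub>R f (x t)) \<le> e * norm h"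
          by (simp add: mult.commute flip: scaleR_diff_right)
      qed
    qed
    show "(\<lambda>n. u (Suc n) 0) \<longlonglongrightarrow> x 0"
      using tendsto_uniform_limitI[OF x, of 0] T by (auto intro: LIMSEQ_Suc)
  qed (use T in auto)
  then obtain g where g: "\<And>t. t \<in> {0..T} \<Longrightarrow> (\<lambda>n. u (Suc n) t) \<longlonglongrightarrow> g t"
      "\<And>t. t \<in> {0..T} \<Longrightarrow> (g has_derivative (\<lambda>h. h *\<^sub>R f (x t))) (at t within {0..T})"
    by blast
  have gx: "g t = x t" if "t \<in> {0..T}" for t
    using LIMSEQ_unique[OF g(1)[OF that] LIMSEQ_Suc[OF tendsto_uniform_limitI[OF x that]]] .
  have "(\<lambda>n. u n 0) \<longlonglongrightarrow> x0"
    by (rule LIMSEQ_offset[where k=1]) (simp add: uS)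
  from LIMSEQ_unique[OF tendsto_uniform_limitI[OF x] this] gx[of 0] T have "g 0 = x0"
    by simp
  then show thesis
    using g(2) gx by (intro that[of g]) (auto simp: has_vector_derivative_def)
qed

section \<open>Growth of norms along curves\<close>

lemma has_real_derivative_inner:
  fixes x y :: "real \<Rightarrow> 'a::real_inner"
  assumes "(x has_vector_derivative x') (at t within S)" "(y has_vector_derivative y') (at t within S)"
  shows "((\<lambda>s. x s \<bullet> y s) has_real_derivative (x t \<bullet> y' + x' \<bullet> y t)) (at t within S)"
  using bounded_bilinear.has_vector_derivative[OF bounded_bilinear_inner assms]
  by (simp add: has_real_derivative_iff_has_vector_derivative)

text \<open>The derivative of \<open>norm (x s)^2\<close> is \<open>2 * (x s \<bullet> v s)\<close>.
  With \<open>K = 0\<close> this gives contraction, with \<open>K\<close> the sum of the weights an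
  a priori bound. No derivative is asked for at time 0, where solutions started on the boundary may
  fail to have one.\<close>

lemma norm_square_growth:
  fixes x :: "real \<Rightarrow> 'a::real_inner"
  assumes t: "t \<in> {0..T}" and cont: "continuous_on {0..T} x"
    and der: "\<And>s. s \<in> {0<..<T} \<Longrightarrow> (x has_vector_derivative v s) (at s)"
    and le: "\<And>s. s \<in> {0<..<T} \<Longrightarrow> x s \<bullet> v s \<le> K"
  shows "norm (x t)^2 \<le> norm (x 0)^2 + 2 * K * t"
proof -
  have "x t \<bullet> x t - 2 * K * t \<le> x 0 \<bullet> x 0 - 2 * K * 0"
  proof (rule DERIV_nonpos_imp_decreasing_open[where f="\<lambda>s. x s \<bullet> x s - 2 * K * s"])
    fix s assume s: "0 < s" "s < t"
    with t have s': "s \<in> {0<..<T}" by auto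
    have "((\<lambda>s. x s \<bullet> x s - 2 * K * s) has_real_derivative (x s \<bullet> v s + v s \<bullet> x s - 2 * K)) (at s)"
      by (auto intro!: derivative_eq_intros has_real_derivative_inner der s')
    then show "\<exists>y. ((\<lambda>s. x s \<bullet> x s - 2 * K * s) has_real_derivative y) (at s) \<and> y \<le> 0"
      using le[OF s'] by (intro exI conjI) (auto simp: inner_commute)
  qed (use t in \<open>auto intro!: continuous_intros continuous_on_subset[OF cont]\<close>)
  then show ?thesis by (simp add: power2_norm_eq_inner)
qed

section \<open>The truncated logarithm\<close>

text \<open>Below \<open>e\<close> the function \<open>- ln\<close> is continued by its tangent at
  \<open>e\<close>, which keeps it continuously differentiable. The case distinction is a set
  membership to fit the rule for derivatives of piecewise functions.\<close>

definition trunc_neg_ln :: "real \<Rightarrow> real \<Rightarrow> real" where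
  "trunc_neg_ln e s = (if s \<in> {e..} then - ln s else - ln e - (s - e) / e)"

lemma DERIV_trunc_neg_ln:
  assumes "e > 0"
  shows "(trunc_neg_ln e has_real_derivative - (1 / max s e)) (at s)"
proof -
  have "((\<lambda>s. if s \<in> {e..} then - ln s else - ln e - (s - e) / e) has_vector_derivative
      (if s \<in> {e..} then - (1 / s) else - (1 / e))) (at s within UNIV)"
    by (rule has_vector_derivative_If_within_closures[where T="{..<e}"])
      (use assms in \<open>auto simp flip: has_real_derivative_iff_has_vector_derivative
        intro!: derivative_eq_intros\<close>)
  then show ?thesis
    by (auto simp: has_real_derivative_iff_has_vector_derivative trunc_neg_ln_def[abs_def] max_def
        split: if_splits)
qed

lemma trunc_neg_ln_eq: "e \<le> s \<Longrightarrow> trunc_neg_ln e s = - ln s"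
  by (simp add: trunc_neg_ln_def)

lemma trunc_neg_ln_ge: "s < e \<Longrightarrow> 0 < e \<Longrightarrow> - ln e \<le> trunc_neg_ln e s"
  by (simp add: trunc_neg_ln_def divide_nonpos_pos)

text \<open>The lower bound does not depend on \<open>e\<close>, so constants derived from it can be
  fixed before the truncation level is chosen.\<close>

lemma trunc_neg_ln_ge_of_le:
  assumes "0 < e" "e \<le> M" "s \<le> M"
  shows "- ln M \<le> trunc_neg_ln e s"
proof (cases "e \<le> s")
  case False
  moreover have "ln e \<le> ln M" using assms by simp
  ultimately show ?thesis using trunc_neg_ln_ge[of s e] assms by linarith
qed (use assms in \<open>simp add: trunc_neg_ln_eq\<close>)

lemma inverse_max_lipschitz:
  fixes e r s :: real
  assumes "e > 0"
  shows "\<bar>1 / max s e - 1 / max r e\<bar> \<le> \<bar>s - r\<bar> / e\<^sup>2"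
proof -
  have pos: "max s e > 0" "max r e > 0" "e\<^sup>2 > 0" using assms by auto
  have "\<bar>1 / max s e - 1 / max r e\<bar> = \<bar>max r e - max s e\<bar> / (max s e * max r e)"
    using pos by (simp add: divide_simps abs_divide abs_mult)
  also have "\<dots> \<le> \<bar>s - r\<bar> / (max s e * max r e)"
    using pos by (intro divide_right_mono) auto
  also have "\<dots> \<le> \<bar>s - r\<bar> / e\<^sup>2"
    using pos assms unfolding power2_eq_square by (intro divide_left_mono mult_mono mult_pos_pos) auto
  finally show ?thesis .
qed

section \<open>Logarithmic barriers on a polyhedral cone\<close>

text \<open>The interior point \<open>w\<close> serves to push boundary points into the cone and as
  the reference point in the energy bound.\<close>

locale log_barrier =
  fixes I :: "'i set" and a :: "'i \<Rightarrow> 'a::euclidean_space" and c :: "'i \<Rightarrow> real" and w :: 'a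
  assumes fin: "finite I" and c_pos: "\<And>i. i \<in> I \<Longrightarrow> c i > 0"
    and w_pos: "\<And>i. i \<in> I \<Longrightarrow> a i \<bullet> w > 0"
begin

definition cone :: "'a set" where
  "cone = {x. \<forall>i\<in>I. a i \<bullet> x > 0}"

definition drift :: "'a \<Rightarrow> 'a" where
  "drift x = (\<Sum>i\<in>I. (c i / (a i \<bullet> x)) *\<^sub>R a i)"

text \<open>The minus sign sits on the logarithm so that the sum has the shape
  \<open>\<Sum>j\<in>I. c j * p j\<close> treated in \<open>weighted_terms_bounded\<close>.\<close>

definition energy :: "'a \<Rightarrow> real" where
  "energy x = (\<Sum>i\<in>I. c i * - ln (a i \<bullet> x))"

lemma coneD: "x \<in> cone \<Longrightarrow> i \<in> I \<Longrightarrow> a i \<bullet> x > 0"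
  by (simp add: cone_def)

lemma open_cone: "open cone"
proof -
  have "cone = (\<Inter>i\<in>I. {x. 0 < a i \<bullet> x})" by (auto simp: cone_def)
  then show ?thesis using fin by (auto intro!: open_INT open_halfspace_gt[of 0, simplified])
qed

lemma drift_inner: "v \<bullet> drift x = (\<Sum>i\<in>I. c i * ((a i \<bullet> v) / (a i \<bullet> x)))"
  unfolding drift_def by (simp add: inner_sum_right inner_commute)

lemma continuous_on_drift: "continuous_on cone drift"
  unfolding drift_def using coneD by (intro continuous_intros) force

lemma continuous_on_energy: "continuous_on cone energy"
  unfolding energy_def using coneD by (intro continuous_intros) force+

text \<open>The function \<open>1 / s\<close> is decreasing: with \<open>r = a i \<bullet> x\<close>
  and \<open>s = a i \<bullet> y\<close>, each form contributes
  \<open>- c i * (r - s)^2 / (r * s)\<close>.\<close>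

lemma drift_monotone:
  assumes "x \<in> cone" "y \<in> cone"
  shows "(x - y) \<bullet> (drift x - drift y) \<le> 0"
proof -
  have "(x - y) \<bullet> (drift x - drift y) =
      (\<Sum>i\<in>I. c i * ((a i \<bullet> x - a i \<bullet> y) / (a i \<bullet> x) - (a i \<bullet> x - a i \<bullet> y) / (a i \<bullet> y)))"
    unfolding inner_diff_right drift_inner
    by (simp add: right_diff_distrib inner_diff_right flip: sum_subtractf)
  also have "\<dots> \<le> 0"
  proof (intro sum_nonpos mult_nonneg_nonpos)
    fix i assume i: "i \<in> I"
    define r s where "r = a i \<bullet> x" and "s = a i \<bullet> y"
    have rs: "r > 0" "s > 0" using assms i by (auto simp: r_def s_def coneD)
    have "(r - s) / r - (r - s) / s = - ((r - s)\<^sup>2 / (r * s))"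
      using rs by (simp add: field_simps power2_eq_square)
    with rs show "(a i \<bullet> x - a i \<bullet> y) / (a i \<bullet> x) - (a i \<bullet> x - a i \<bullet> y) / (a i \<bullet> y) \<le> 0"
      by (simp flip: r_def s_def)
  qed (use c_pos in \<open>auto intro: less_imp_le\<close>)
  finally show ?thesis .
qed

text \<open>This is the tangent inequality of the convex function \<open>energy\<close>, whose
  gradient at \<open>x\<close> is \<open>- drift x\<close>; termwise it is the concavity of
  \<open>ln\<close>.\<close>

lemma drift_le_energy_diff:
  assumes "x \<in> cone" "z \<in> cone"
  shows "(x - z) \<bullet> drift x \<le> energy z - energy x"
proof -
  have "c i * ((a i \<bullet> (x - z)) / (a i \<bullet> x)) \<le> c i * - ln (a i \<bullet> z) - c i * - ln (a i \<bullet> x)"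
    if i: "i \<in> I" for i
  proof -
    have rs: "a i \<bullet> x > 0" "a i \<bullet> z > 0" using assms i by (auto simp: coneD)
    have "(a i \<bullet> (x - z)) / (a i \<bullet> x) \<le> ln (a i \<bullet> x) - ln (a i \<bullet> z)"
      using ln_diff_le[OF rs(2,1)] rs by (simp add: inner_diff_right diff_divide_distrib)
    then have "c i * ((a i \<bullet> (x - z)) / (a i \<bullet> x)) \<le> c i * (ln (a i \<bullet> x) - ln (a i \<bullet> z))"
      using c_pos[OF i] by (intro mult_left_mono) auto
    then show ?thesis by (simp add: algebra_simps)
  qed
  then show ?thesis
    unfolding drift_inner energy_def by (simp only: flip: sum_subtractf) (rule sum_mono)
qed

text \<open>The chain rule, identifying \<open>drift\<close> as the negative gradient of
  \<open>energy\<close>.\<close>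

lemma has_real_derivative_energy:
  assumes "(x has_vector_derivative v) (at t)" "x t \<in> cone"
  shows "((\<lambda>s. energy (x s)) has_real_derivative - (v \<bullet> drift (x t))) (at t)"
proof -
  have "((\<lambda>s. a i \<bullet> x s) has_real_derivative a i \<bullet> v) (at t)" for i
    using has_real_derivative_inner[OF has_vector_derivative_const assms(1)] by simp
  then have "((\<lambda>s. energy (x s)) has_real_derivative (\<Sum>i\<in>I. c i * - ((a i \<bullet> v) / (a i \<bullet> x t)))) (at t)"
    unfolding energy_def using coneD[OF assms(2)]
    by (auto intro!: derivative_eq_intros sum.cong simp: divide_inverse)
  then show ?thesis by (simp add: drift_inner sum_negf)
qed

lemma linear_forms_bounded:
  obtains M where "M \<ge> 1" "\<And>y i. norm y \<le> R \<Longrightarrow> i \<in> I \<Longrightarrow> a i \<bullet> y \<le> M"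
proof
  show "1 + (\<Sum>i\<in>I. norm (a i) * \<bar>R\<bar>) \<ge> 1" by (simp add: sum_nonneg)
  fix y :: 'a and i assume "norm y \<le> R" and i: "i \<in> I"
  then have "a i \<bullet> y \<le> norm (a i) * \<bar>R\<bar>"
    by (intro order_trans[OF norm_cauchy_schwarz] mult_left_mono) auto
  also have "\<dots> \<le> (\<Sum>i\<in>I. norm (a i) * \<bar>R\<bar>)"
    by (rule member_le_sum) (use i fin in auto)
  finally show "a i \<bullet> y \<le> 1 + (\<Sum>i\<in>I. norm (a i) * \<bar>R\<bar>)" by simp
qed

text \<open>Adding \<open>m\<close> makes all terms nonnegative, so each is at most the whole sum.
  The constant depends only on \<open>m\<close> and \<open>D\<close>, and \<open>p\<close> is
  arbitrary, so that the bound covers both the energy and its truncations.\<close>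

lemma weighted_terms_bounded:
  obtains P where
    "\<And>p i. (\<And>j. j \<in> I \<Longrightarrow> - m \<le> p j) \<Longrightarrow> (\<Sum>j\<in>I. c j * p j) \<le> D \<Longrightarrow> i \<in> I \<Longrightarrow> p i \<le> P"
proof
  fix p i assume p: "\<And>j. j \<in> I \<Longrightarrow> - m \<le> p j" "(\<Sum>j\<in>I. c j * p j) \<le> D" and i: "i \<in> I"
  let ?E = "D + (\<Sum>j\<in>I. c j * m)"
  have "c i * (p i + m) \<le> (\<Sum>j\<in>I. c j * (p j + m))"
  proof (rule member_le_sum[OF i _ fin, of "\<lambda>j. c j * (p j + m)"])
    show "0 \<le> c j * (p j + m)" if "j \<in> I - {i}" for j
      using p(1)[of j] c_pos[of j] that by (intro mult_nonneg_nonneg) auto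
  qed
  also have "\<dots> \<le> ?E"
    using p(2) by (simp add: distrib_left sum.distrib)
  finally have "p i + m \<le> ?E / c i"
    using c_pos[OF i] by (simp add: field_simps)
  also have "\<dots> \<le> \<bar>?E\<bar> / c i"
    using c_pos[OF i] by (intro divide_right_mono) auto
  also have "\<dots> \<le> (\<Sum>j\<in>I. \<bar>?E\<bar> / c j)"
    by (rule member_le_sum) (use i fin c_pos in \<open>auto intro!: divide_nonneg_pos\<close>)
  finally show "p i \<le> (\<Sum>j\<in>I. \<bar>?E\<bar> / c j) - m" by simp
qed

text \<open>A norm bound caps every \<open>a i \<bullet> y\<close>, hence bounds every logarithmic
  term from below; bounded energy then bounds each of them from above.\<close>

lemma sublevel_away_from_boundary:
  obtains d where "d > 0"
    "\<And>y i. y \<in> cone \<Longrightarrow> energy y \<le> D \<Longrightarrow> norm y \<le> R \<Longrightarrow> i \<in> I \<Longrightarrow> d \<le> a i \<bullet> y"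
proof -
  obtain M where M: "M \<ge> 1" "\<And>y i. norm y \<le> R \<Longrightarrow> i \<in> I \<Longrightarrow> a i \<bullet> y \<le> M"
    using linear_forms_bounded[of R] by blast
  obtain P where P: "\<And>p i. (\<And>j. j \<in> I \<Longrightarrow> - ln M \<le> p j) \<Longrightarrow> (\<Sum>j\<in>I. c j * p j) \<le> D \<Longrightarrow>
      i \<in> I \<Longrightarrow> p i \<le> P"
    using weighted_terms_bounded[of "ln M" D] by blast
  show thesis
  proof (rule that[of "exp (- P)"])
    fix y i assume y: "y \<in> cone" "energy y \<le> D" "norm y \<le> R" and i: "i \<in> I"
    have "- ln (a i \<bullet> y) \<le> P"
    proof (rule P[where p="\<lambda>j. - ln (a j \<bullet> y)", OF _ _ i])
      show "- ln M \<le> - ln (a j \<bullet> y)" if "j \<in> I" for j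
        using M(2)[OF y(3) that] coneD[OF y(1) that] by simp
    qed (use y(2) in \<open>simp add: energy_def\<close>)
    then show "exp (- P) \<le> a i \<bullet> y"
      using coneD[OF y(1) i] by (simp add: ln_ge_iff[symmetric])
  qed simp
qed

section \<open>Trajectories and their a priori estimates\<close>

text \<open>The equation is imposed on the open interval only, so that \<open>x 0\<close> may lie on
  the boundary of the cone.\<close>

definition trajectory :: "real \<Rightarrow> (real \<Rightarrow> 'a) \<Rightarrow> bool" where
  "trajectory T x \<longleftrightarrow> continuous_on {0..T} x \<and>
    (\<forall>t\<in>{0<..<T}. x t \<in> cone \<and> (x has_vector_derivative drift (x t)) (at t))"

text \<open>Monotonicity of the drift makes the squared distance nonincreasing.\<close>

lemma trajectory_contraction:
  assumes "trajectory T x" "trajectory T y" and t: "t \<in> {0..T}"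
  shows "norm (x t - y t) \<le> norm (x 0 - y 0)"
proof -
  have "norm (x t - y t)^2 \<le> norm (x 0 - y 0)^2 + 2 * 0 * t"
    using assms drift_monotone
    by (intro norm_square_growth[OF t, where v="\<lambda>s. drift (x s) - drift (y s)"])
      (auto simp: trajectory_def intro!: continuous_intros has_vector_derivative_diff)
  then show ?thesis by (simp add: power2_le_iff_abs_le)
qed

text \<open>Monotonicity of \<open>s \<mapsto> (norm (x s - z))\<^sup>2 / 2 + s * (energy (x s) - energy z)\<close> gives a bound
  on the energy at positive times that does not involve the energy at time \<open>0\<close>.\<close>
lemma trajectory_energy_bound:
  assumes x: "trajectory T x" "x 0 \<in> cone" and z: "z \<in> cone" and t: "0 < t" "t < T"
  shows "energy (x t) \<le> energy z + norm (x 0 - z)^2 / (2 * t)"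
proof -
  define G where "G s = ((x s - z) \<bullet> (x s - z)) / 2 + s * (energy (x s) - energy z)" for s
  have cone: "x s \<in> cone" if "s \<in> {0..<T}" for s
    using x that by (cases "s = 0") (auto simp: trajectory_def)
  have contx: "continuous_on {0..t} x"
    using x(1) t by (auto simp: trajectory_def intro: continuous_on_subset)
  have "G t \<le> G 0"
  proof (rule DERIV_nonpos_imp_decreasing_open[where f=G])
    fix s assume s: "0 < s" "s < t"
    with t have xs: "x s \<in> cone" by (intro cone) auto
    have der: "(x has_vector_derivative drift (x s)) (at s)"
      using x s t by (auto simp: trajectory_def)
    note d[derivative_intros] = has_real_derivative_energy[OF der xs]
      has_real_derivative_inner[OF has_vector_derivative_diff_const[THEN iffD2, OF der]
        has_vector_derivative_diff_const[THEN iffD2, OF der], of z z]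
    \<comment> \<open>The last term is the decay of the energy along its own gradient flow; the sum
      of the first two is nonpositive by convexity.\<close>
    have "(G has_real_derivative
        (x s - z) \<bullet> drift (x s) + (energy (x s) - energy z) - s * (drift (x s) \<bullet> drift (x s))) (at s)"
      unfolding G_def by (auto intro!: derivative_eq_intros simp: inner_commute)
    moreover have "0 \<le> s * (drift (x s) \<bullet> drift (x s))" using s by simp
    then have "(x s - z) \<bullet> drift (x s) + (energy (x s) - energy z) - s * (drift (x s) \<bullet> drift (x s)) \<le> 0"
      using drift_le_energy_diff[OF xs z] by linarith
    ultimately show "\<exists>y. (G has_real_derivative y) (at s) \<and> y \<le> 0"
      by blast
  next
    \<comment> \<open>Continuity at time 0 uses \<open>x 0 \<in> cone\<close>; hence the bound is
      applied to the approximating flows and not directly to their limit.\<close>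
    show "continuous_on {0..t} G"
      unfolding G_def using cone t
      by (intro continuous_intros contx continuous_on_compose2[OF continuous_on_energy contx]) auto
  qed (use t in simp)
  then have "norm (x t - z)^2 / 2 + t * (energy (x t) - energy z) \<le> norm (x 0 - z)^2 / 2"
    by (simp add: G_def power2_norm_eq_inner)
  then have "t * (energy (x t) - energy z) \<le> norm (x 0 - z)^2 / 2"
    using zero_le_power2[of "norm (x t - z)"] by linarith
  then show ?thesis
    using t by (simp add: field_simps)
qed

section \<open>Existence from interior points\<close>

text \<open>Truncating \<open>1 / s\<close> to \<open>1 / max s e\<close> makes the drift Lipschitz but keeps it a gradient. Along
  its flow the truncated energy decreases, which for small \<open>e\<close> confines the flow to the region where
  nothing was truncated.\<close>
lemma trajectory_exists_cone:
  assumes p: "p \<in> cone" and T: "0 \<le> T"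
  obtains x where "trajectory T x" "x 0 = p"
proof -
  define K where "K = sum c I"
  have K: "K \<ge> 0" using c_pos by (auto simp: K_def intro: sum_nonneg less_imp_le)
  \<comment> \<open>This radius bounds the truncated flow up to time \<open>T\<close> for every
    truncation level, so \<open>R\<close>, \<open>M\<close> and \<open>P\<close> can be fixed before
    \<open>e\<close>.\<close>
  define R where "R = sqrt (norm p ^ 2 + 2 * K * T)"
  obtain M where M: "M \<ge> 1" "\<And>y i. norm y \<le> R \<Longrightarrow> i \<in> I \<Longrightarrow> a i \<bullet> y \<le> M"
    using linear_forms_bounded[of R] by blast
  obtain P where P: "\<And>q i. (\<And>j. j \<in> I \<Longrightarrow> - ln M \<le> q j) \<Longrightarrow> (\<Sum>j\<in>I. c j * q j) \<le> energy p \<Longrightarrow>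
      i \<in> I \<Longrightarrow> q i \<le> P"
    using weighted_terms_bounded[of "ln M" "energy p"] by blast
  \<comment> \<open>Three demands: \<open>e \<le> 1 \<le> M\<close>; \<open>- ln e > P\<close>,
    strict thanks to the \<open>- 1\<close>; and \<open>e \<le> a i \<bullet> p\<close>, so that
    nothing is truncated at the starting point.\<close>
  define e where "e = Min (insert 1 (insert (exp (- P - 1)) ((\<lambda>i. a i \<bullet> p) ` I)))"
  have e_pos: "e > 0"
    using fin p by (auto simp: e_def coneD)
  have e_le: "e \<le> 1" "e \<le> exp (- P - 1)" "\<And>i. i \<in> I \<Longrightarrow> e \<le> a i \<bullet> p"
    unfolding e_def by (rule Min_le; simp add: fin)+
  have "ln e \<le> ln (exp (- P - 1))"
    using e_le(2) e_pos by (subst ln_le_cancel_iff) auto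
  then have ln_e: "P < - ln e" by simp
  define f where "f x = (\<Sum>i\<in>I. (c i / max (a i \<bullet> x) e) *\<^sub>R a i)" for x
  have f_inner: "v \<bullet> f x = (\<Sum>i\<in>I. c i * ((a i \<bullet> v) / max (a i \<bullet> x) e))" for v x
    unfolding f_def by (simp add: inner_sum_right inner_commute)
  have "(\<Sum>i\<in>I. c i * norm (a i)^2 / e\<^sup>2)-lipschitz_on UNIV f"
  proof (rule lipschitz_onI)
    fix x y :: 'a
    have "norm (f x - f y) \<le> (\<Sum>i\<in>I. norm ((c i / max (a i \<bullet> x) e) *\<^sub>R a i - (c i / max (a i \<bullet> y) e) *\<^sub>R a i))"
      unfolding f_def by (simp only: flip: sum_subtractf) (rule norm_sum)
    also have "\<dots> \<le> (\<Sum>i\<in>I. c i * norm (a i)^2 / e\<^sup>2 * norm (x - y))"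
    proof (rule sum_mono)
      fix i assume i: "i \<in> I"
      have "norm ((c i / max (a i \<bullet> x) e) *\<^sub>R a i - (c i / max (a i \<bullet> y) e) *\<^sub>R a i)
          = c i * \<bar>1 / max (a i \<bullet> x) e - 1 / max (a i \<bullet> y) e\<bar> * norm (a i)"
      proof -
        have "(c i / max (a i \<bullet> x) e) *\<^sub>R a i - (c i / max (a i \<bullet> y) e) *\<^sub>R a i
            = (c i * (1 / max (a i \<bullet> x) e - 1 / max (a i \<bullet> y) e)) *\<^sub>R a i"
          by (simp add: algebra_simps)
        then show ?thesis using c_pos[OF i] by (simp add: abs_mult)
      qed
      also have "\<dots> \<le> c i * ((norm (a i) * norm (x - y)) / e\<^sup>2) * norm (a i)"
      proof (intro mult_right_mono mult_left_mono)
        have "\<bar>a i \<bullet> x - a i \<bullet> y\<bar> \<le> norm (a i) * norm (x - y)"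
          by (metis Cauchy_Schwarz_ineq2 inner_diff_right)
        then have "\<bar>a i \<bullet> x - a i \<bullet> y\<bar> / e\<^sup>2 \<le> norm (a i) * norm (x - y) / e\<^sup>2"
          by (rule divide_right_mono) simp
        with inverse_max_lipschitz[OF e_pos, of "a i \<bullet> x" "a i \<bullet> y"]
        show "\<bar>1 / max (a i \<bullet> x) e - 1 / max (a i \<bullet> y) e\<bar> \<le> norm (a i) * norm (x - y) / e\<^sup>2"
          by linarith
      qed (use c_pos[OF i] in auto)
      finally show "norm ((c i / max (a i \<bullet> x) e) *\<^sub>R a i - (c i / max (a i \<bullet> y) e) *\<^sub>R a i)
          \<le> c i * norm (a i)^2 / e\<^sup>2 * norm (x - y)"
        by (simp add: power2_eq_square ac_simps)
    qed
    finally show "dist (f x) (f y) \<le> (\<Sum>i\<in>I. c i * norm (a i)^2 / e\<^sup>2) * dist x y"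
      by (simp add: dist_norm sum_distrib_right)
  qed (intro sum_nonneg divide_nonneg_nonneg mult_nonneg_nonneg less_imp_le[OF c_pos]; simp)
  from global_picard_lindelof[OF this T] obtain x where x0: "x 0 = p"
    and derx: "\<And>t. t \<in> {0..T} \<Longrightarrow> (x has_vector_derivative f (x t)) (at t within {0..T})"
    by blast
  have contx: "continuous_on {0..T} x"
    by (rule continuous_on_vector_derivative[OF derx])
  have der: "(x has_vector_derivative f (x t)) (at t)" if "t \<in> {0<..<T}" for t
    using derx[of t] that by (simp add: at_within_Icc_at)
  have norm_le: "norm (x t) \<le> R" if t: "t \<in> {0..T}" for t
  proof -
    have "norm (x t)^2 \<le> norm (x 0)^2 + 2 * K * t"
    proof (rule norm_square_growth[OF t contx der])
      fix s
      have "c i * (a i \<bullet> x s / max (a i \<bullet> x s) e) \<le> c i * 1" if "i \<in> I" for i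
        using c_pos[OF that] e_pos by (intro mult_left_mono) (auto simp: divide_le_eq)
      then show "x s \<bullet> f (x s) \<le> K"
        unfolding f_inner K_def by (simp add: sum_mono)
    qed
    also have "\<dots> \<le> norm p ^ 2 + 2 * K * T"
      using t K by (simp add: x0 mult_left_mono)
    finally show ?thesis unfolding R_def by (rule real_le_rsqrt)
  qed
  define E where "E t = (\<Sum>i\<in>I. c i * trunc_neg_ln e (a i \<bullet> x t))" for t
  have E0: "E 0 = energy p"
    using e_le(3) by (auto simp: E_def energy_def x0 trunc_neg_ln_eq)
  have E_le: "E t \<le> energy p" if t: "t \<in> {0..T}" for t
    unfolding E0[symmetric]
  proof (rule DERIV_nonpos_imp_decreasing_open[where f=E])
    fix s assume "0 < s" "s < t"
    with t have "(x has_vector_derivative f (x s)) (at s)" by (intro der) auto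
    from has_real_derivative_inner[OF has_vector_derivative_const this]
    have "((\<lambda>s. a i \<bullet> x s) has_real_derivative a i \<bullet> f (x s)) (at s)" for i by simp
    from DERIV_chain2[OF DERIV_trunc_neg_ln[OF e_pos] this]
    have "(E has_real_derivative (\<Sum>i\<in>I. c i * (- (1 / max (a i \<bullet> x s) e) * (a i \<bullet> f (x s))))) (at s)"
      unfolding E_def by (intro DERIV_sum DERIV_cmult)
    \<comment> \<open>The field \<open>f\<close> is the negative gradient of the truncated energy,
      so the derivative is minus a square.\<close>
    also have "(\<Sum>i\<in>I. c i * (- (1 / max (a i \<bullet> x s) e) * (a i \<bullet> f (x s)))) = - (f (x s) \<bullet> f (x s))"
      unfolding f_inner by (simp add: sum_negf)
    finally show "\<exists>y. (E has_real_derivative y) (at s) \<and> y \<le> 0" by (intro exI conjI) auto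
  next
    have "continuous_on UNIV (trunc_neg_ln e)"
      using DERIV_isCont[OF DERIV_trunc_neg_ln[OF e_pos]] by (simp add: continuous_at_imp_continuous_on)
    moreover have "continuous_on {0..t} (\<lambda>s. a i \<bullet> x s)" for i
      using t by (intro continuous_intros continuous_on_subset[OF contx]) auto
    ultimately have "continuous_on {0..t} (\<lambda>s. trunc_neg_ln e (a i \<bullet> x s))" for i
      using continuous_on_compose2 by blast
    then show "continuous_on {0..t} E"
      unfolding E_def by (intro continuous_intros)
  qed (use t in simp)
  \<comment> \<open>A form below \<open>e\<close> would have a term of at least
    \<open>- ln e\<close>, which exceeds the bound \<open>P\<close> on every single term.\<close>
  have untruncated: "e \<le> a i \<bullet> x t" if t: "t \<in> {0..T}" and i: "i \<in> I" for t i
  proof (rule ccontr)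
    assume "\<not> e \<le> a i \<bullet> x t"
    then have "P < trunc_neg_ln e (a i \<bullet> x t)"
      using trunc_neg_ln_ge[of "a i \<bullet> x t" e] ln_e e_pos by linarith
    moreover have "trunc_neg_ln e (a i \<bullet> x t) \<le> P"
      using E_le[OF t] M(1) e_le(1) e_pos M(2)[OF norm_le[OF t]]
      by (intro P[where q="\<lambda>i. trunc_neg_ln e (a i \<bullet> x t)", OF _ _ i] trunc_neg_ln_ge_of_le)
        (auto simp: E_def)
    ultimately show False by simp
  qed
  have "f (x t) = drift (x t)" if "t \<in> {0..T}" for t
    unfolding f_def drift_def using untruncated[OF that] by (simp add: max_absorb1)
  moreover have "x t \<in> cone" if "t \<in> {0..T}" for t
    using untruncated[OF that] e_pos by (force simp: cone_def)
  ultimately show thesis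
    using der contx x0 by (intro that[of x]) (auto simp: trajectory_def)
qed

section \<open>Flows from boundary points as limits\<close>

lemma trajectory_mono: "trajectory T x \<Longrightarrow> S \<le> T \<Longrightarrow> trajectory S x"
  by (auto simp: trajectory_def intro: continuous_on_subset)

text \<open>Near \<open>t\<close> almost all \<open>u n\<close> stay in a compact ball inside the
  cone. There the drift is uniformly continuous, so the derivatives converge uniformly and the limit
  may be differentiated.\<close>

lemma has_vector_derivative_uniform_limit:
  assumes traj: "\<And>n. trajectory (real n) (u n)" and t: "0 < t" "x t \<in> cone"
    and lim: "\<And>T. uniform_limit {0..T} u x sequentially" and cont: "isCont x t"
  shows "(x has_vector_derivative drift (x t)) (at t)"
proof -
  obtain r where r: "r > 0" "cball (x t) r \<subseteq> cone"
    using open_cone t(2) by (meson open_contains_cball)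
  obtain d0 where d0: "d0 > 0" "\<And>s. dist s t < d0 \<Longrightarrow> dist (x s) (x t) < r / 2"
    using cont r(1) unfolding continuous_at by (metis LIM_def half_gt_zero dist_self)
  define d where "d = min d0 t"
  define S where "S = {t - d<..<t + d}"
  have d: "d > 0" using d0 t by (simp add: d_def)
  have S: "open S" "convex S" "t \<in> S" "S \<subseteq> {0..t + d}" "S \<subseteq> {0<..<t + d}"
    using d by (auto simp: S_def d_def)
  have near: "dist (x s) (x t) < r / 2" if "s \<in> S" for s
    using that by (intro d0(2)) (auto simp: S_def d_def dist_real_def)
  have limS: "uniform_limit S u x sequentially"
    using lim S(4) by (rule uniform_limit_on_subset)
  have "\<forall>\<^sub>F n in sequentially. \<forall>s\<in>S. dist (u n s) (x s) < r / 2"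
    using uniform_limitD[OF limS, of "r / 2"] r(1) by simp
  then have inball: "\<forall>\<^sub>F n in sequentially. \<forall>s\<in>S. u n s \<in> cball (x t) r"
  proof (eventually_elim, intro ballI)
    fix n s assume "\<forall>s\<in>S. dist (u n s) (x s) < r / 2" "s \<in> S"
    then show "u n s \<in> cball (x t) r"
      using near[of s] dist_triangle[of "u n s" "x t" "x s"] by (force simp: dist_commute)
  qed
  have "uniformly_continuous_on (cball (x t) r) drift"
    using continuous_on_subset[OF continuous_on_drift r(2)]
    by (intro compact_uniformly_continuous) auto
  then have lim_drift: "uniform_limit S (\<lambda>n s. drift (u n s)) (\<lambda>s. drift (x s)) sequentially"
    using inball by (intro uniform_limit_compose_uniformly_continuous_on[OF limS]) auto
  \<comment> \<open>Only for \<open>n \<ge> N\<close> is the window \<open>S\<close> inside the time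
    interval of \<open>u n\<close>; this is why the sequence is shifted.\<close>
  obtain N :: nat where N: "t + d \<le> real N" using real_arch_simple by blast
  have "\<exists>g. \<forall>s\<in>S. (\<lambda>n. u (n + N) s) \<longlonglongrightarrow> g s \<and>
      (g has_derivative (\<lambda>h. h *\<^sub>R drift (x s))) (at s within S)"
  proof (rule has_derivative_sequence)
    show "(u (n + N) has_derivative (\<lambda>h. h *\<^sub>R drift (u (n + N) s))) (at s within S)"
      if "s \<in> S" for n s
    proof -
      have "s \<in> {0<..<real (n + N)}" using that S(5) N by auto
      then have "(u (n + N) has_vector_derivative drift (u (n + N) s)) (at s)"
        using traj[of "n + N"] unfolding trajectory_def by blast
      then show ?thesis
        unfolding has_vector_derivative_def by (rule has_derivative_at_withinI)
    qed
    show "\<forall>\<^sub>F n in sequentially. \<forall>s\<in>S. \<forall>h.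
        norm (h *\<^sub>R drift (u (n + N) s) - h *\<^sub>R drift (x s)) \<le> e * norm h" if "e > 0" for e
    proof -
      have "\<forall>\<^sub>F n in sequentially. \<forall>s\<in>S. dist (drift (u (n + N) s)) (drift (x s)) < e"
        using uniform_limitD[OF lim_drift that] by (rule sequentially_offset)
      then show ?thesis
      proof (eventually_elim, intro ballI allI)
        fix n s h assume "\<forall>s\<in>S. dist (drift (u (n + N) s)) (drift (x s)) < e" "s \<in> S"
        then have "\<bar>h\<bar> * norm (drift (u (n + N) s) - drift (x s)) \<le> \<bar>h\<bar> * e"
          by (intro mult_left_mono) (auto simp: dist_norm less_imp_le)
        then show "norm (h *\<^sub>R drift (u (n + N) s) - h *\<^sub>R drift (x s)) \<le> e * norm h"
          by (simp add: mult.commute flip: scaleR_diff_right)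
      qed
    qed
    show "(\<lambda>n. u (n + N) t) \<longlonglongrightarrow> x t"
      using tendsto_uniform_limitI[OF limS S(3)] by (rule LIMSEQ_ignore_initial_segment)
  qed (use S in auto)
  then obtain g where g: "\<And>s. s \<in> S \<Longrightarrow> (\<lambda>n. u (n + N) s) \<longlonglongrightarrow> g s"
      "(g has_derivative (\<lambda>h. h *\<^sub>R drift (x t))) (at t within S)"
    using S(3) by blast
  have "g s = x s" if "s \<in> S" for s
    using LIMSEQ_unique[OF g(1)[OF that]
        LIMSEQ_ignore_initial_segment[OF tendsto_uniform_limitI[OF limS that]]] .
  moreover have "(g has_vector_derivative drift (x t)) (at t)"
    using g(2) unfolding has_vector_derivative_def at_within_open[OF S(3,1)] .
  ultimately show ?thesis
    using has_vector_derivative_transform_within_open[OF _ S(1,3)] by blast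
qed

theorem flow_exists:
  assumes x0: "\<And>i. i \<in> I \<Longrightarrow> a i \<bullet> x0 \<ge> 0"
  obtains x where "continuous_on {0..} x" "x 0 = x0"
    "\<And>t. t > 0 \<Longrightarrow> x t \<in> cone" "\<And>t. t > 0 \<Longrightarrow> (x has_vector_derivative drift (x t)) (at t)"
proof -
  \<comment> \<open>A positive multiple of \<open>w\<close> moves a point of the closed cone into
    the open one.\<close>
  define p where "p n = x0 + inverse (real (Suc n)) *\<^sub>R w" for n
  have p_cone: "p n \<in> cone" for n
    using x0 w_pos by (auto simp: cone_def p_def inner_add_right intro!: add_nonneg_pos)
  have p_lim: "p \<longlonglongrightarrow> x0"
    unfolding p_def using tendsto_add[OF tendsto_const
        tendsto_scaleR[OF LIMSEQ_inverse_real_of_nat tendsto_const]] by fastforce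
  \<comment> \<open>The time horizon grows with \<open>n\<close>, so every fixed time is eventually
    covered.\<close>
  have "\<exists>u. trajectory (real n) u \<and> u 0 = p n" for n
    using trajectory_exists_cone[OF p_cone, of "real n"] by (metis of_nat_0_le_iff)
  then obtain u where traj: "\<And>n. trajectory (real n) (u n)" and u0: "\<And>n. u n 0 = p n"
    by metis
  have contr: "norm (u m t - u n t) \<le> norm (p m - p n)"
    if "0 \<le> t" "t \<le> real m" "t \<le> real n" for m n t
    using trajectory_contraction[of t "u m" "u n" t] that traj u0
    by (auto intro: trajectory_mono)
  have "convergent (\<lambda>n. u n t)" if t: "0 \<le> t" for t
  proof (rule Cauchy_convergent, rule metric_CauchyI)
    fix e :: real assume "e > 0"
    then obtain M where M: "\<And>m n. m \<ge> M \<Longrightarrow> n \<ge> M \<Longrightarrow> dist (p m) (p n) < e"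
      using metric_CauchyD[OF LIMSEQ_imp_Cauchy[OF p_lim]] by blast
    obtain N where N: "t \<le> real N" using real_arch_simple by blast
    show "\<exists>M. \<forall>m\<ge>M. \<forall>n\<ge>M. dist (u m t) (u n t) < e"
    proof (intro exI allI impI)
      fix m n assume "max M N \<le> m" "max M N \<le> n"
      then show "dist (u m t) (u n t) < e"
        using contr[of t m n] M[of m n] t N by (simp add: dist_norm)
    qed
  qed
  then obtain x where x: "\<And>t. 0 \<le> t \<Longrightarrow> (\<lambda>n. u n t) \<longlonglongrightarrow> x t"
    unfolding convergent_def by metis
  \<comment> \<open>Letting \<open>m\<close> tend to infinity in \<open>contr\<close> gives a rate
    independent of \<open>t\<close>, hence uniform convergence.\<close>
  have dist_le: "norm (u n t - x t) \<le> norm (p n - x0)" if "0 \<le> t" "t \<le> real n" for n t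
  proof (rule LIMSEQ_le)
    show "(\<lambda>m. norm (u n t - u m t)) \<longlonglongrightarrow> norm (u n t - x t)"
      using that by (intro tendsto_intros x)
    show "(\<lambda>m. norm (p n - p m)) \<longlonglongrightarrow> norm (p n - x0)"
      by (intro tendsto_intros p_lim)
    show "\<exists>N. \<forall>m\<ge>N. norm (u n t - u m t) \<le> norm (p n - p m)"
      using contr[of t n] that by (intro exI[of _ n]) auto
  qed
  have lim: "uniform_limit {0..T} u x sequentially" for T
  proof (rule uniform_limitI)
    fix e :: real assume "e > 0"
    then have "\<forall>\<^sub>F n in sequentially. dist (p n) x0 < e"
      using p_lim by (rule tendstoD[rotated])
    moreover have "\<forall>\<^sub>F n in sequentially. T \<le> real n"
      using filterlim_real_sequentially by (simp add: filterlim_at_top)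
    ultimately show "\<forall>\<^sub>F n in sequentially. \<forall>t\<in>{0..T}. dist (u n t) (x t) < e"
    proof (eventually_elim, intro ballI)
      fix n t assume "dist (p n) x0 < e" "T \<le> real n" "t \<in> {0..T}"
      then show "dist (u n t) (x t) < e"
        using dist_le[of t n] by (auto simp: dist_norm)
    qed
  qed
  have contT: "continuous_on {0..T} x" for T
  proof (rule uniform_limit_theorem[OF _ lim])
    have "\<forall>\<^sub>F n in sequentially. T \<le> real n"
      using filterlim_real_sequentially by (simp add: filterlim_at_top)
    then show "\<forall>\<^sub>F n in sequentially. continuous_on {0..T} (u n)"
    proof eventually_elim
      fix n assume "T \<le> real n"
      then show "continuous_on {0..T} (u n)"
        using trajectory_mono[OF traj] by (auto simp: trajectory_def)
    qed
  qed simp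
  have cont: "continuous_on {0..} x"
    unfolding continuous_on_eq_continuous_within
  proof
    fix t :: real assume "t \<in> {0..}"
    then have "continuous (at t within {0..t + 1}) x"
      using contT[of "t + 1"] by (auto simp: continuous_on_eq_continuous_within)
    moreover have "at t within {0..t + 1} = at t within {0..}"
      by (rule at_within_nhd[of _ "{..<t + 1}"]) auto
    ultimately show "continuous (at t within {0..}) x" by simp
  qed
  have x_cone: "x t \<in> cone" if t: "0 < t" for t
  proof -
    have "Bseq (\<lambda>n. u n t)"
      by (rule convergent_imp_Bseq, rule convergentI, rule x) (use t in simp)
    then obtain R where R: "\<And>n. norm (u n t) \<le> R"
      unfolding Bseq_def by blast
    have "Bseq (\<lambda>n. p n - w)"
      by (rule convergent_imp_Bseq, rule convergentI, rule tendsto_diff[OF p_lim tendsto_const])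
    then obtain B where B: "\<And>n. norm (p n - w) \<le> B"
      unfolding Bseq_def by blast
    \<comment> \<open>The distance \<open>d\<close> depends on \<open>t\<close> but not on
      \<open>n\<close>; the non-strict bound \<open>d \<le> a i \<bullet> u n t\<close> survives the
      limit, which mere positivity would not.\<close>
    obtain d where d: "d > 0" "\<And>y i. y \<in> cone \<Longrightarrow> energy y \<le> energy w + B\<^sup>2 / (2 * t) \<Longrightarrow>
        norm y \<le> R \<Longrightarrow> i \<in> I \<Longrightarrow> d \<le> a i \<bullet> y"
      using sublevel_away_from_boundary[of "energy w + B\<^sup>2 / (2 * t)" R] by blast
    have "d \<le> a i \<bullet> x t" if i: "i \<in> I" for i
    proof (rule LIMSEQ_le_const)
      show "(\<lambda>n. a i \<bullet> u n t) \<longlonglongrightarrow> a i \<bullet> x t"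
        using t by (intro tendsto_intros x) simp
      obtain N where N: "t < real N" using reals_Archimedean2 by blast
      have "d \<le> a i \<bullet> u n t" if "n \<ge> N" for n
      proof (rule d(2)[OF _ _ R i])
        have tn: "t < real n" using N that by simp
        then show "u n t \<in> cone" using traj[of n] t by (auto simp: trajectory_def)
        have "energy (u n t) \<le> energy w + norm (p n - w)^2 / (2 * t)"
          using trajectory_energy_bound[OF traj _ _ t tn, of w] p_cone w_pos
          by (simp add: u0 cone_def)
        also have "norm (p n - w)^2 / (2 * t) \<le> B\<^sup>2 / (2 * t)"
          using B t by (intro divide_right_mono power_mono) auto
        finally show "energy (u n t) \<le> energy w + B\<^sup>2 / (2 * t)" by simp
      qed
      then show "\<exists>N. \<forall>n\<ge>N. d \<le> a i \<bullet> u n t" by blast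
    qed
    with d(1) show ?thesis by (force simp: cone_def)
  qed
  have "x 0 = x0"
    using LIMSEQ_unique[OF x[of 0]] p_lim by (simp add: u0)
  moreover have "isCont x t" if "0 < t" for t
    using continuous_on_interior[OF cont] that by simp
  ultimately show thesis
    using cont x_cone has_vector_derivative_uniform_limit[OF traj _ _ lim] by (intro that[of x]) auto
qed

theorem flow_unique:
  assumes "continuous_on {0..} x" "continuous_on {0..} y" "x 0 = y 0" "0 \<le> t"
    and "\<And>s. s > 0 \<Longrightarrow> x s \<in> cone" "\<And>s. s > 0 \<Longrightarrow> (x has_vector_derivative drift (x s)) (at s)"
    and "\<And>s. s > 0 \<Longrightarrow> y s \<in> cone" "\<And>s. s > 0 \<Longrightarrow> (y has_vector_derivative drift (y s)) (at s)"
  shows "x t = y t"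
proof -
  have "trajectory t x" "trajectory t y"
    using assms by (auto simp: trajectory_def intro: continuous_on_subset)
  from trajectory_contraction[OF this, of t] assms show ?thesis by simp
qed

end

section \<open>The root system of type B\<close>

text \<open>The positive roots of type \<open>B\<close>, indexed by pairs so that the off-diagonal
  pairs \<open>(i, j)\<close> and \<open>(j, i)\<close> share the two roots \<open>e\<^sub>i - e\<^sub>j\<close> and \<open>e\<^sub>i + e\<^sub>j\<close>.\<close>
definition root_B :: "'n \<times> 'n \<Rightarrow> real ^ 'n::{finite,linorder}" where
  "root_B = (\<lambda>(i, j). if i < j then axis i 1 - axis j 1
     else if j < i then axis i 1 + axis j 1 else axis i 1)"

text \<open>The diagonal pairs carry the short roots, whose terms have the coefficient
  \<open>\<nu>\<close>.\<close>

definition weight_B :: "real \<Rightarrow> 'n \<times> 'n::{finite,linorder} \<Rightarrow> real" where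
  "weight_B \<nu> = (\<lambda>(i, j). if i = j then \<nu> else 1)"

text \<open>In the order of the index type this is the vector (N, N-1, ..., 1); it is the interior
  point \<open>w\<close> of the locale.\<close>

definition rho_B :: "real ^ 'n::{finite,linorder}" where
  "rho_B = (\<chi> i. real (card {i..}))"

lemma inner_root_B:
  "root_B (i, j) \<bullet> x = (if i < j then x $ i - x $ j else if j < i then x $ i + x $ j else x $ i)"
  by (simp add: root_B_def inner_diff_left inner_add_left inner_axis')

lemma root_B_nth:
  "root_B (i, j) $ k = (if i = k then 1 else 0) +
    (if j = k then (if i < j then - 1 else if j < i then 1 else 0) else 0)"
  by (auto simp: root_B_def axis_def)

lemma open_weyl_chamber_B_iff_roots: "x \<in> open_weyl_chamber_B \<longleftrightarrow> (\<forall>r. root_B r \<bullet> x > 0)"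
proof
  assume "x \<in> open_weyl_chamber_B"
  then show "\<forall>r. root_B r \<bullet> x > 0"
    by (auto simp: open_weyl_chamber_B_def inner_root_B add_pos_pos)
next
  assume pos: "\<forall>r. root_B r \<bullet> x > 0"
  have "x $ j < x $ i" if "i < j" for i j
    using pos[rule_format, of "(i, j)"] that by (simp add: inner_root_B)
  moreover have "0 < x $ i" for i
    using pos[rule_format, of "(i, i)"] by (simp add: inner_root_B)
  ultimately show "x \<in> open_weyl_chamber_B"
    by (simp add: open_weyl_chamber_B_def)
qed

lemma weyl_chamber_B_roots_nonneg: "x \<in> weyl_chamber_B \<Longrightarrow> root_B r \<bullet> x \<ge> 0"
  by (cases r) (auto simp: weyl_chamber_B_def inner_root_B)

lemma open_weyl_chamber_B_subset: "open_weyl_chamber_B \<subseteq> weyl_chamber_B"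
  by (auto simp: open_weyl_chamber_B_def weyl_chamber_B_def less_imp_le)

lemma rho_B_in_open_weyl_chamber_B:
  "(rho_B :: real ^ 'n::{finite,linorder}) \<in> open_weyl_chamber_B"
proof -
  have "card {j..} < card {i..}" if "i < j" for i j :: 'n
    using that by (intro psubset_card_mono) auto
  moreover have "0 < card {i..}" for i :: 'n
    by (auto simp: card_gt_0_iff)
  ultimately show ?thesis
    by (simp add: open_weyl_chamber_B_def rho_B_def)
qed

lemma log_barrier_B: "\<nu> > 0 \<Longrightarrow> log_barrier UNIV root_B (weight_B \<nu>) rho_B"
  using rho_B_in_open_weyl_chamber_B
  by unfold_locales (auto simp: weight_B_def open_weyl_chamber_B_iff_roots)

lemma cone_B:
  fixes \<nu> :: real
  assumes "\<nu> > 0"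
  shows "log_barrier.cone UNIV root_B = open_weyl_chamber_B"
  using log_barrier.cone_def[OF log_barrier_B[OF assms]] by (auto simp: open_weyl_chamber_B_iff_roots)

text \<open>Only the pairs \<open>(k, j)\<close> and \<open>(j, k)\<close> involve coordinate
  \<open>k\<close>. One of them yields the difference and the other the sum; for
  \<open>j < k\<close> the coefficient \<open>- 1\<close> of the root turns
  \<open>x $ j - x $ k\<close> around. With division by zero equal to zero this holds for all
  \<open>x\<close>.\<close>

lemma drift_B_nth:
  assumes "\<nu> > 0"
  shows "log_barrier.drift UNIV root_B (weight_B \<nu>) x $ k =
    (\<Sum>j\<in>UNIV - {k}. 1 / (x $ k - x $ j) + 1 / (x $ k + x $ j)) + \<nu> / x $ k"
proof -
  \<comment> \<open>Here \<open>g j\<close> is the contribution of \<open>(k, j)\<close> and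
    \<open>h i\<close> that of \<open>(i, k)\<close>; the diagonal pair is counted in
    \<open>g\<close> alone, so \<open>h k = 0\<close>.\<close>
  define g h where
    "g j = (if k < j then 1 / (x $ k - x $ j) else if j < k then 1 / (x $ k + x $ j) else \<nu> / x $ k)" and
    "h j = (if j < k then 1 / (x $ k - x $ j) else if k < j then 1 / (x $ k + x $ j) else 0)" for j
  have entry: "weight_B \<nu> (i, j) / (root_B (i, j) \<bullet> x) * root_B (i, j) $ k
      = (if i = k then g j else 0) + (if j = k then h i else 0)" for i j
  proof -
    have "- 1 / (x $ i - x $ k) = 1 / (x $ k - x $ i)" for i
      by (metis minus_diff_eq minus_divide_divide minus_minus)
    then show ?thesis
      by (auto simp: g_def h_def inner_root_B weight_B_def root_B_nth add.commute)
  qed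
  have "log_barrier.drift UNIV root_B (weight_B \<nu>) x $ k =
      (\<Sum>r\<in>UNIV. weight_B \<nu> r / (root_B r \<bullet> x) * root_B r $ k)"
    by (simp add: log_barrier.drift_def[OF log_barrier_B[OF assms]])
  also have "\<dots> = (\<Sum>i\<in>UNIV. \<Sum>j\<in>UNIV. weight_B \<nu> (i, j) / (root_B (i, j) \<bullet> x) * root_B (i, j) $ k)"
    by (simp add: sum.cartesian_product split_def)
  also have "\<dots> = (\<Sum>i\<in>UNIV. \<Sum>j\<in>UNIV. (if i = k then g j else 0) + (if j = k then h i else 0))"
    by (simp only: entry)
  also have "\<dots> = (\<Sum>j\<in>UNIV. g j + h j)"
    by (simp add: sum.distrib) (simp add: sum.swap[of "\<lambda>i j. if i = k then g j else 0"])
  also have "\<dots> = (g k + h k) + (\<Sum>j\<in>UNIV - {k}. g j + h j)"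
    by (rule sum.remove) auto
  also have "(\<Sum>j\<in>UNIV - {k}. g j + h j) = (\<Sum>j\<in>UNIV - {k}. 1 / (x $ k - x $ j) + 1 / (x $ k + x $ j))"
    by (rule sum.cong) (auto simp: g_def h_def)
  finally show ?thesis by (simp add: g_def h_def)
qed

lemma has_vector_derivative_vec_iff:
  fixes x :: "real \<Rightarrow> real ^ 'n"
  shows "(x has_vector_derivative v) (at t) \<longleftrightarrow> (\<forall>i. ((\<lambda>s. x s $ i) has_real_derivative v $ i) (at t))"
  unfolding has_vector_derivative_def has_derivative_componentwise_within[of x]
  by (auto simp: Basis_vec_def inner_axis has_real_derivative_iff_has_vector_derivative
      has_vector_derivative_def)

theorem theorem3p7:
  fixes \<nu> :: real and x0 :: "real ^ 'n::{finite,linorder}"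
  assumes "CARD('n::{finite,linorder}) \<ge> 2" and "\<nu> > 0" and "x0 \<in> weyl_chamber_B"
  shows "\<exists>!x :: real \<Rightarrow> real ^ 'n::{finite,linorder}.
    x \<in> {0..} \<rightarrow>\<^sub>E weyl_chamber_B \<and>
    continuous_on {0..} x \<and>
    x 0 = x0 \<and>
    (\<forall>t>0. x t \<in> open_weyl_chamber_B) \<and>
    (\<forall>t>0. \<forall>i. ((\<lambda>s. x s $ i) has_real_derivative
        (\<Sum>j\<in>UNIV - {i}. 1 / (x t $ i - x t $ j) + 1 / (x t $ i + x t $ j)) + \<nu> / x t $ i) (at t))"
proof -
  interpret log_barrier "UNIV :: ('n \<times> 'n) set" root_B "weight_B \<nu>" rho_B
    by (rule log_barrier_B) fact
  note cone = cone_B[OF \<open>\<nu> > 0\<close>]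
  have ode: "(\<forall>i. ((\<lambda>s. x s $ i) has_real_derivative
        (\<Sum>j\<in>UNIV - {i}. 1 / (x t $ i - x t $ j) + 1 / (x t $ i + x t $ j)) + \<nu> / x t $ i) (at t))
      \<longleftrightarrow> (x has_vector_derivative drift (x t)) (at t)" for x :: "real \<Rightarrow> real ^ 'n::{finite,linorder}" and t
    by (simp only: has_vector_derivative_vec_iff drift_B_nth[OF \<open>\<nu> > 0\<close>])
  obtain y where y: "continuous_on {0..} y" "y 0 = x0" "\<And>t. t > 0 \<Longrightarrow> y t \<in> cone"
      "\<And>t. t > 0 \<Longrightarrow> (y has_vector_derivative drift (y t)) (at t)"
    using flow_exists[of x0] weyl_chamber_B_roots_nonneg[OF assms(3)] by blast
  \<comment> \<open>Functions in the extensional space take the value \<open>undefined\<close> at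
    negative times; without this convention uniqueness would fail there.\<close>
  define x where "x = restrict y {0..}"
  have xy: "x t = y t" if "0 \<le> t" for t
    using that by (simp add: x_def)
  \<comment> \<open>Restriction changes nothing on the open set \<open>{0<..}\<close>, so two-sided
    derivatives at positive times carry over.\<close>
  have der: "(x has_vector_derivative drift (x t)) (at t)" if "t > 0" for t
    using has_vector_derivative_transform_within_open[OF y(4)[OF that], of "{0<..}" x] that
    by (simp add: xy)
  have "x t \<in> weyl_chamber_B" if "0 \<le> t" for t
    using that y(2,3) assms(3) open_weyl_chamber_B_subset by (cases "t = 0") (auto simp: xy cone)
  then have "x \<in> {0..} \<rightarrow>\<^sub>E weyl_chamber_B"
    by (auto simp: x_def)
  moreover have "continuous_on {0..} x"
    using y(1) continuous_on_cong[of "{0..}" "{0..}" x y] xy by simp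
  ultimately show ?thesis
    unfolding ode
  proof (intro ex1I[of _ x] conjI)
    fix z :: "real \<Rightarrow> real ^ 'n::{finite,linorder}"
    assume z: "z \<in> {0..} \<rightarrow>\<^sub>E weyl_chamber_B \<and> continuous_on {0..} z \<and> z 0 = x0 \<and>
      (\<forall>t>0. z t \<in> open_weyl_chamber_B) \<and> (\<forall>t>0. (z has_vector_derivative drift (z t)) (at t))"
    show "z = x"
    proof (rule extensionalityI)
      show "z t = x t" if "t \<in> {0..}" for t
        using flow_unique[of z y t] z y that by (simp add: xy cone)
    qed (use z in \<open>auto simp: PiE_def x_def\<close>)
  qed (use y(2,3) der in \<open>auto simp: xy cone\<close>)
qed

end
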